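(* Let $f:\mathbb{R}^n\to\mathbb{R}$ be $L$-smooth (not necessarily convex, $L>0$), let $\Psi:\mathbb{R}^n\to\mathbb{R}\cup\{+\infty\}$ be closed, proper and convex, let $F=f+\Psi$, and suppose $F$ attains its minimum at a fixed point $\mathbf{x}^*$. Let $F_*=\inf_{\mathbf{x}\in\mathbb{R}^n}F(\mathbf{x})$ and assume $F_*>-\infty$. Then the points $\mathbf{x}_k$ generated from $\mathbf{x}_0\in\mathbb{R}^n$ by the idealized algorithm described in the context satisfy, for all $k\ge0$, $$\min_{j=0,\ldots,k}\|G_{1/L}(\mathbf{x}_j)\|\le\sqrt{\frac{2L(F(\mathbf{x}_0)-F_* )}{k+1}}.$$
   Context: $f$ is $L$-smooth if it is differentiable and $|f(\mathbf{x})-f(\mathbf{y})-\nabla f(\mathbf{y})^T(\mathbf{x}-\mathbf{y})|\le (L/2)\|\mathbf{x}-\mathbf{y}\|^2$ for all $\mathbf{x},\mathbf{y}$. For $t>0$, $\mathrm{prox}_{t\Psi}(\mathbf{x})=\operatorname{argmin}_{\mathbf{z}}\{\Psi(\mathbf{z})+\|\mathbf{x}-\mathbf{z}\|^2/(2t)\}$, and $G_t(\mathbf{x})=t^{-1}(\mathbf{x}-\mathrm{prox}_{t\Psi}(\mathbf{x}-t\nabla f(\mathbf{x})))$. Idealized algorithm (non-strongly convex and nonconvex case). Set $\mathbf{z}_0=\mathbf{x}_0$, and let $\mathcal{M}_1$ be any affine subspace containing $\mathbf{z}_0+\mathrm{span}\{G_{1/L}(\mathbf{z}_0)\}$. For $k=1,2,\ldots$: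 (1) $\mathbf{y}_k=\operatorname{argmin}\{\|\mathbf{y}-\mathbf{x}^*\|^2:\mathbf{y}\in\mathcal{M}_k\}$. (2) $\mathbf{x}_k\in\operatorname{argmin}\{F(\mathbf{x}):\mathbf{x}\in\mathcal{M}_k\}$ (a minimizer is assumed to exist). (3) $\mathbf{z}_k$ is any point of $\mathcal{M}_k$ with $G_{1/L}(\mathbf{z}_k)^T(\mathbf{y}_k-\mathbf{z}_k)\ge0$ and $-G_{1/L}(\mathbf{z}_k)^T(\mathbf{x}_k-\mathbf{z}_k)\le0$. (4) $\mathcal{M}_{k+1}$ is any affine subspace containing $\{\mathbf{z}_k+\mathrm{span}\{G_{1/L}(\mathbf{z}_k)\}\}\cup\{\mathbf{y}_k+\mathrm{span}\{G_{1/L}(\mathbf{z}_k)\}\}\cup\{\mathbf{x}_k+\mathrm{span}\{G_{1/L}(\mathbf{x}_k)\}\}$. *)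

theory Defs
  imports "HOL-Analysis.Analysis"
begin

definition grad :: "('a::real_inner \<Rightarrow> real) \<Rightarrow> 'a \<Rightarrow> 'a"
  where "grad f x = (THE d. GDERIV f x :> d)"

lemma GDERIV_unique:
  assumes "GDERIV f x :> d" "GDERIV f x :> d'"
  shows "d = d'"
proof -
  have "(\<lambda>h. inner h d) = (\<lambda>h. inner h d')"
    using assms unfolding gderiv_def by (rule has_derivative_unique)
  then have "inner h (d - d') = 0" for h
    by (metis inner_diff_right diff_self)
  then show ?thesis
    by (metis inner_eq_zero_iff right_minus_eq)
qed

lemma grad_eqI: "GDERIV f x :> d \<Longrightarrow> grad f x = d"
  unfolding grad_def by (blast intro: GDERIV_unique)

definition L_smooth :: "real \<Rightarrow> ('a::real_inner \<Rightarrow> real) \<Rightarrow> bool"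
  where "L_smooth L f \<longleftrightarrow>
    (\<forall>x. f differentiable (at x)) \<and>
    (\<forall>x y. \<bar>f x - f y - grad f y \<bullet> (x - y)\<bar> \<le> (L / 2) * (norm (x - y))\<^sup>2)"

definition ereal_epigraph :: "('a \<Rightarrow> ereal) \<Rightarrow> ('a \<times> real) set"
  where "ereal_epigraph \<Psi> = {(x, r). \<Psi> x \<le> ereal r}"

(* Closedness and convexity of an extended-valued function are those of its epigraph. *)
definition closed_proper_convex :: "('a::real_normed_vector \<Rightarrow> ereal) \<Rightarrow> bool"
  where "closed_proper_convex \<Psi> \<longleftrightarrow>
    closed (ereal_epigraph \<Psi>) \<and>
    ((\<forall>x. \<Psi> x \<noteq> -\<infinity>) \<and> (\<exists>x. \<Psi> x \<noteq> \<infinity>)) \<and>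
    convex (ereal_epigraph \<Psi>)"

definition prox :: "real \<Rightarrow> ('a::real_normed_vector \<Rightarrow> ereal) \<Rightarrow> 'a \<Rightarrow> 'a"
  where "prox t \<Psi> x =
    arg_min (\<lambda>z. \<Psi> z + ereal ((norm (x - z))\<^sup>2 / (2 * t))) (\<lambda>_. True)"

definition grad_map :: "('a::real_inner \<Rightarrow> real) \<Rightarrow> ('a \<Rightarrow> ereal) \<Rightarrow> real \<Rightarrow> 'a \<Rightarrow> 'a"
  where "grad_map f \<Psi> t x = (1 / t) *\<^sub>R (x - prox t \<Psi> (x - t *\<^sub>R grad f x))"

definition composite :: "('a \<Rightarrow> real) \<Rightarrow> ('a \<Rightarrow> ereal) \<Rightarrow> 'a \<Rightarrow> ereal"
  where "composite f \<Psi> x = ereal (f x) + \<Psi> x"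

definition line_along :: "'a::real_vector \<Rightarrow> 'a \<Rightarrow> 'a set"
  where "line_along p v = (\<lambda>w. p + w) ` span {v}"

(* The sequences x, y, z, M form a run of the algorithm with reference point xs (a minimizer
   of the composite objective). The starting point is x 0; y 0 and M 0 play no role. *)
definition idealized_run ::
  "('a::real_inner \<Rightarrow> real) \<Rightarrow> ('a \<Rightarrow> ereal) \<Rightarrow> real \<Rightarrow> 'a \<Rightarrow>
   (nat \<Rightarrow> 'a) \<Rightarrow> (nat \<Rightarrow> 'a) \<Rightarrow> (nat \<Rightarrow> 'a) \<Rightarrow> (nat \<Rightarrow> 'a set) \<Rightarrow> bool"
  where "idealized_run f \<Psi> L xs x y z M \<longleftrightarrow>
    (let G = grad_map f \<Psi> (1 / L) in
      z 0 = x 0 \<and>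
      affine (M 1) \<and> line_along (z 0) (G (z 0)) \<subseteq> M 1 \<and>
      (\<forall>k\<ge>1.
        is_arg_min (\<lambda>v. (norm (v - xs))\<^sup>2) (\<lambda>v. v \<in> M k) (y k) \<and>
        is_arg_min (composite f \<Psi>) (\<lambda>v. v \<in> M k) (x k) \<and>
        z k \<in> M k \<and>
        G (z k) \<bullet> (y k - z k) \<ge> 0 \<and>
        - (G (z k) \<bullet> (x k - z k)) \<le> 0 \<and>
        affine (M (k + 1)) \<and>
        line_along (z k) (G (z k)) \<union> line_along (y k) (G (z k)) \<union> line_along (x k) (G (x k))
          \<subseteq> M (k + 1)))"

(* Square root extended by sqrt \<infinity> = \<infinity>, needed because the objective may be \<infinity> at the
   starting point. *)
definition ereal_sqrt :: "ereal \<Rightarrow> ereal"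
  where "ereal_sqrt a = (case a of ereal r \<Rightarrow> ereal (sqrt r) | PInfty \<Rightarrow> \<infinity> | MInfty \<Rightarrow> -\<infinity>)"

end

theory Submission
  imports Defs
begin

text \<open>
  The prox-gradient step \<open>u = x - G x / L\<close> decreases \<open>F\<close> by at least \<open>\<parallel>G x\<parallel>\<^sup>2 / (2L)\<close>, by
  \<open>L\<close>-smoothness of \<open>f\<close> and strong convexity of the prox objective. Since \<open>u\<close> at \<open>x\<^sub>k\<close> lies in
  \<open>M\<^sub>k\<^sub>+\<^sub>1\<close>, over which \<open>x\<^sub>k\<^sub>+\<^sub>1\<close> minimizes \<open>F\<close>, these decreases telescope.
  The prox objective attains its minimum because a lower bound of \<open>F\<close> bounds it from below and its
  minimizing sequences are Cauchy.
\<close>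

lemma epigraph_convexD:
  assumes "convex (ereal_epigraph \<Psi>)" "\<Psi> u \<le> ereal a" "\<Psi> v \<le> ereal b" "0 \<le> t" "t \<le> 1"
  shows "\<Psi> ((1 - t) *\<^sub>R u + t *\<^sub>R v) \<le> ereal ((1 - t) * a + t * b)"
  using convexD_alt[OF assms(1), of "(u, a)" "(v, b)" t] assms(2-)
  by (simp add: ereal_epigraph_def)

text \<open>The last term measures strong convexity. It gives both the Cauchy estimate for
  minimizing sequences and the quadratic growth around the prox point.\<close>

lemma norm_diff_convex_combination:
  fixes w u v :: "'a::real_inner"
  shows "(norm (w - ((1 - t) *\<^sub>R u + t *\<^sub>R v)))\<^sup>2 =
    (1 - t) * (norm (w - u))\<^sup>2 + t * (norm (w - v))\<^sup>2 - t * (1 - t) * (norm (u - v))\<^sup>2"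
  unfolding power2_norm_eq_inner
  by (simp add: inner_simps inner_commute algebra_simps power2_eq_square)

text \<open>The bound \<open>lower\<close> is a hypothesis because the caller reads it off from a
  lower bound of the composite objective, so no affine minorant of \<open>\<Psi>\<close> has to be
  constructed. The limit point comes from completeness rather than compactness.\<close>

lemma prox_objective_attains_min:
  fixes \<Psi> :: "'a::{real_inner, complete_space} \<Rightarrow> ereal"
  assumes t: "t > 0"
    and closed: "closed (ereal_epigraph \<Psi>)" and convex: "convex (ereal_epigraph \<Psi>)"
    and p: "\<Psi> p \<noteq> \<infinity>"
    and lower: "\<And>z. ereal m \<le> \<Psi> z + ereal ((norm (w - z))\<^sup>2 / (2 * t))"
  shows "\<exists>u. is_arg_min (\<lambda>z. \<Psi> z + ereal ((norm (w - z))\<^sup>2 / (2 * t))) (\<lambda>_. True) u"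
proof -
  define q where "q z = (norm (w - z))\<^sup>2 / (2 * t)" for z
  \<comment> \<open>Running over the epigraph keeps all values real even where \<open>\<Psi>\<close>
    is infinite, so \<open>I\<close> can be a real infimum.\<close>
  define S where "S = (\<lambda>(z, r). r + q z) ` ereal_epigraph \<Psi>"
  define I where "I = Inf S"
  have q_comb: "q ((1 - s) *\<^sub>R u + s *\<^sub>R v) =
      (1 - s) * q u + s * q v - s * (1 - s) * (norm (u - v))\<^sup>2 / (2 * t)" for s u v
    unfolding q_def norm_diff_convex_combination using t by (simp add: field_simps)
  have fin: "\<Psi> z \<noteq> -\<infinity>" for z
    using lower[of z] by auto
  have SI: "r + q z \<in> S" if "\<Psi> z \<le> ereal r" for z r
    using that by (force simp: S_def ereal_epigraph_def)
  have "m \<le> s" if "s \<in> S" for s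
  proof -
    from that obtain z r where zr: "\<Psi> z \<le> ereal r" "s = r + q z"
      by (auto simp: S_def ereal_epigraph_def)
    have "ereal m \<le> ereal r + ereal (q z)"
      using lower[of z] add_right_mono[OF zr(1)] unfolding q_def by (rule order_trans)
    with zr show ?thesis by simp
  qed
  then have bdd: "bdd_below S" by (rule bdd_belowI)
  have I_le: "I \<le> r + q z" if "\<Psi> z \<le> ereal r" for z r
    unfolding I_def by (rule cInf_lower[OF SI[OF that] bdd])
  obtain c where "\<Psi> p = ereal c"
    using p fin[of p] by (cases "\<Psi> p") auto
  then have "S \<noteq> {}" using SI[of p c] by auto
  have "\<exists>z r. \<Psi> z \<le> ereal r \<and> r + q z < I + 1 / Suc n" for n
  proof -
    have "Inf S < I + 1 / Suc n" by (simp add: I_def)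
    from cInf_lessD[OF \<open>S \<noteq> {}\<close> this] show ?thesis
      by (auto simp: S_def ereal_epigraph_def)
  qed
  then obtain z r where zr: "\<And>n. \<Psi> (z n) \<le> ereal (r n)"
    and near: "\<And>n. r n + q (z n) < I + 1 / Suc n"
    by metis
  \<comment> \<open>The midpoint value is at least \<open>I\<close>, yet strong convexity puts it
    below the average of the two near-optimal values by
    \<open>(norm (z i - z j))\<^sup>2 / (8 * t)\<close>.\<close>
  have gap: "(norm (z i - z j))\<^sup>2 \<le> 4 * t * (1 / Suc i + 1 / Suc j)" for i j
  proof -
    have "I \<le> (1/2 * r i + 1/2 * r j) + q ((1/2) *\<^sub>R z i + (1/2) *\<^sub>R z j)"
      using I_le[OF epigraph_convexD[OF convex zr zr, of "1/2" i j]] by simp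
    also have "q ((1/2) *\<^sub>R z i + (1/2) *\<^sub>R z j) =
        1/2 * q (z i) + 1/2 * q (z j) - (norm (z i - z j))\<^sup>2 / (8 * t)"
      using q_comb[of "1/2" "z i" "z j"] by simp
    finally have "(norm (z i - z j))\<^sup>2 / (8 * t) \<le> 1/2 * (1 / Suc i + 1 / Suc j)"
      using near[of i] near[of j] by argo
    then show ?thesis using t by (simp add: field_simps del: of_nat_Suc)
  qed
  have "Cauchy z"
  proof (rule metric_CauchyI)
    fix e :: real assume e: "e > 0"
    \<comment> \<open>Beyond \<open>N\<close> the bound in \<open>gap\<close> is at most
      \<open>8 * t / Suc N\<close>, which must fall below the square of \<open>e\<close>.\<close>
    then obtain N :: nat where N: "8 * t / e\<^sup>2 < N" using reals_Archimedean2 by blast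
    have "dist (z i) (z j) < e" if ij: "i \<ge> N" "j \<ge> N" for i j
    proof -
      have "1 / real (Suc i) + 1 / real (Suc j) \<le> 1 / Suc N + 1 / Suc N"
        using ij by (intro add_mono divide_left_mono) auto
      then have "4 * t * (1 / real (Suc i) + 1 / real (Suc j)) \<le> 4 * t * (1 / Suc N + 1 / Suc N)"
        using t by (intro mult_left_mono) auto
      also have "\<dots> = 8 * t / Suc N" by simp
      also have "\<dots> < e\<^sup>2"
      proof -
        have "8 * t < N * e\<^sup>2" using N e by (simp add: field_simps)
        also have "\<dots> \<le> Suc N * e\<^sup>2" by (intro mult_right_mono) auto
        finally show ?thesis by (simp add: field_simps del: of_nat_Suc)
      qed
      finally have "(norm (z i - z j))\<^sup>2 < e\<^sup>2" using gap[of i j] by linarith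
      then show ?thesis using e by (simp add: dist_norm power2_less_imp_less)
    qed
    then show "\<exists>N. \<forall>i\<ge>N. \<forall>j\<ge>N. dist (z i) (z j) < e" by blast
  qed
  then obtain u where u: "z \<longlonglongrightarrow> u"
    using Cauchy_convergent_iff convergent_def by blast
  have q_lim: "(\<lambda>n. q (z n)) \<longlonglongrightarrow> q u"
    unfolding q_def using t by (intro tendsto_intros u) auto
  have "(\<lambda>n. r n + q (z n)) \<longlonglongrightarrow> I"
  proof (rule tendsto_sandwich[where f = "\<lambda>_. I" and h = "\<lambda>n. I + 1 / Suc n"])
    show "(\<lambda>n. I + 1 / Suc n) \<longlonglongrightarrow> I"
      using tendsto_add[OF tendsto_const LIMSEQ_Suc[OF lim_1_over_n]] by simp
    show "(\<lambda>n. I) \<longlonglongrightarrow> I" by simp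
    show "eventually (\<lambda>n. I \<le> r n + q (z n)) sequentially"
      using I_le[OF zr] by simp
    show "eventually (\<lambda>n. r n + q (z n) \<le> I + 1 / Suc n) sequentially"
      by (intro always_eventually allI less_imp_le near)
  qed
  \<comment> \<open>The heights converge as well, so closedness of the epigraph applies to the pairs
    and takes the place of lower semicontinuity.\<close>
  then have "r \<longlonglongrightarrow> I - q u" using tendsto_diff[OF _ q_lim] by fastforce
  with u have "(\<lambda>n. (z n, r n)) \<longlonglongrightarrow> (u, I - q u)" by (rule tendsto_Pair)
  then have "(u, I - q u) \<in> ereal_epigraph \<Psi>"
    by (rule closed_sequentially[OF closed, rotated]) (simp add: ereal_epigraph_def zr)
  then have "\<Psi> u \<le> ereal (I - q u)" by (simp add: ereal_epigraph_def)
  from add_right_mono[OF this, of "ereal (q u)"] have le: "\<Psi> u + ereal (q u) \<le> ereal I" by simp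
  have "\<Psi> u + ereal (q u) \<le> \<Psi> v + ereal (q v)" for v
  proof (cases "\<Psi> v")
    case (real b)
    then show ?thesis using I_le[of v b] le by (simp add: order_trans)
  qed (use fin in auto)
  then show ?thesis unfolding q_def by (auto simp: is_arg_min_linorder)
qed

text \<open>Quadratic growth: compare \<open>u\<close> with the points of the segment towards
  \<open>v\<close>, cancel the common factor \<open>s\<close>, and let \<open>s\<close> tend to
  0.\<close>

lemma prox_objective_strong_min:
  fixes \<Psi> :: "'a::real_inner \<Rightarrow> ereal"
  assumes t: "t > 0" and convex: "convex (ereal_epigraph \<Psi>)"
    and min: "is_arg_min (\<lambda>z. \<Psi> z + ereal ((norm (w - z))\<^sup>2 / (2 * t))) (\<lambda>_. True) u"
    and a: "\<Psi> u = ereal a" and b: "\<Psi> v = ereal b"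
  shows "a + (norm (w - u))\<^sup>2 / (2 * t) + (norm (u - v))\<^sup>2 / (2 * t)
    \<le> b + (norm (w - v))\<^sup>2 / (2 * t)"
proof -
  define q where "q z = (norm (w - z))\<^sup>2 / (2 * t)" for z
  define d where "d = (norm (u - v))\<^sup>2 / (2 * t)"
  have bound: "a + q u + (1 - s) * d \<le> b + q v" if s: "0 < s" "s < 1" for s
  proof -
    let ?c = "(1 - s) *\<^sub>R u + s *\<^sub>R v"
    have "ereal a + ereal (q u) \<le> \<Psi> ?c + ereal (q ?c)"
      using min a by (simp add: is_arg_min_linorder q_def)
    also have "\<dots> \<le> ereal ((1 - s) * a + s * b) + ereal (q ?c)"
      using a b s by (intro add_right_mono epigraph_convexD[OF convex]) auto
    finally have "a + q u \<le> (1 - s) * a + s * b + q ?c" by simp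
    also have "q ?c = (1 - s) * q u + s * q v - s * (1 - s) * d"
      unfolding q_def d_def norm_diff_convex_combination using t by (simp add: field_simps)
    \<comment> \<open>All terms free of \<open>s\<close> cancel, which leaves a factor
      \<open>s\<close> on both sides.\<close>
    finally have "s * (a + q u + (1 - s) * d) \<le> s * (b + q v)"
      by (simp add: algebra_simps)
    then show ?thesis using s by simp
  qed
  \<comment> \<open>The limit removes the loss factor \<open>1 - s\<close> in front of
    \<open>d\<close>.\<close>
  have "((\<lambda>s. a + q u + (1 - s) * d) \<longlongrightarrow> a + q u + (1 - 0) * d) (at_right 0)"
    by (intro tendsto_intros)
  moreover have "eventually (\<lambda>s. a + q u + (1 - s) * d \<le> b + q v) (at_right (0::real))"
    using bound by (auto simp: eventually_at_right_field intro!: exI[of _ 1])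
  ultimately have "a + q u + (1 - 0) * d \<le> b + q v"
    by (rule tendsto_upperbound) simp
  then show ?thesis by (simp add: q_def d_def)
qed

text \<open>The bound \<open>lower\<close> guarantees that the prox minimum is attained; otherwise
  the choice operator in \<open>prox\<close> would return an arbitrary point.\<close>

lemma prox_gradient_descent:
  fixes f :: "'a::{real_inner, complete_space} \<Rightarrow> real"
  assumes L: "L > 0" and smooth: "L_smooth L f" and cpc: "closed_proper_convex \<Psi>"
    and lower: "\<And>v. ereal m \<le> composite f \<Psi> v"
  defines "G \<equiv> grad_map f \<Psi> (1 / L)"
  shows "composite f \<Psi> (x - (1 / L) *\<^sub>R G x) + ereal ((norm (G x))\<^sup>2 / (2 * L)) \<le> composite f \<Psi> x"
proof (cases "\<Psi> x = \<infinity>")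
  case True
  then show ?thesis by (simp add: composite_def)
next
  case False
  define g where "g = grad f x"
  define w where "w = x - (1 / L) *\<^sub>R g"
  define u where "u = prox (1 / L) \<Psi> w"
  have fin: "\<Psi> v \<noteq> -\<infinity>" for v using cpc by (simp add: closed_proper_convex_def)
  then obtain b where b: "\<Psi> x = ereal b" using False by (cases "\<Psi> x") auto
  have G: "G x = L *\<^sub>R (x - u)"
    by (simp add: G_def grad_map_def u_def w_def g_def)
  \<comment> \<open>Completing the square: up to a constant, the proximity term is the quadratic
    model of \<open>f\<close> at \<open>x\<close> that bounds \<open>f\<close> from above.\<close>
  have expand: "(norm (w - v))\<^sup>2 / (2 * (1 / L)) =
      L / 2 * (norm (v - x))\<^sup>2 + g \<bullet> (v - x) + (norm g)\<^sup>2 / (2 * L)" for v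
    unfolding power2_norm_eq_inner w_def using L
    by (simp add: inner_simps inner_commute field_simps)
  have quad: "f v \<le> f x + g \<bullet> (v - x) + L / 2 * (norm (v - x))\<^sup>2" for v
  proof -
    have "\<bar>f v - f x - g \<bullet> (v - x)\<bar> \<le> L / 2 * (norm (v - x))\<^sup>2"
      using smooth unfolding L_smooth_def g_def by blast
    then show ?thesis by linarith
  qed
  \<comment> \<open>The model dominates \<open>f\<close>, so a lower bound of the composite
    objective carries over to the prox objective.\<close>
  have "ereal (m - f x + (norm g)\<^sup>2 / (2 * L)) \<le> \<Psi> v + ereal ((norm (w - v))\<^sup>2 / (2 * (1 / L)))" for v
    using lower[of v] quad[of v] fin[of v] unfolding expand composite_def
    by (cases "\<Psi> v") auto
  then have "\<exists>u. is_arg_min (\<lambda>z. \<Psi> z + ereal ((norm (w - z))\<^sup>2 / (2 * (1 / L)))) (\<lambda>_. True) u"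
    using L cpc False unfolding closed_proper_convex_def
    by (intro prox_objective_attains_min) auto
  then have min: "is_arg_min (\<lambda>z. \<Psi> z + ereal ((norm (w - z))\<^sup>2 / (2 * (1 / L)))) (\<lambda>_. True) u"
    unfolding u_def prox_def arg_min_def by (rule someI_ex)
  then have "\<Psi> u + ereal ((norm (w - u))\<^sup>2 / (2 * (1 / L)))
      \<le> \<Psi> x + ereal ((norm (w - x))\<^sup>2 / (2 * (1 / L)))"
    by (simp add: is_arg_min_linorder)
  \<comment> \<open>Comparison with \<open>x\<close>, where \<open>\<Psi>\<close> is finite, forces
    \<open>\<Psi> u\<close> to be finite.\<close>
  then obtain a where a: "\<Psi> u = ereal a" using b fin[of u] by (cases "\<Psi> u") auto
  have "a + (norm (w - u))\<^sup>2 / (2 * (1 / L)) + (norm (u - x))\<^sup>2 / (2 * (1 / L))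
      \<le> b + (norm (w - x))\<^sup>2 / (2 * (1 / L))"
    using L cpc by (intro prox_objective_strong_min[OF _ _ min a b])
      (auto simp: closed_proper_convex_def)
  moreover have "(norm (u - x))\<^sup>2 / (2 * (1 / L)) = L / 2 * (norm (u - x))\<^sup>2" by simp
  \<comment> \<open>One half of the coefficient \<open>L\<close> comes from the model and the other
    from quadratic growth. Bounding \<open>f u\<close> by the model then spends only one
    half.\<close>
  ultimately have "a + L * (norm (u - x))\<^sup>2 + g \<bullet> (u - x) \<le> b"
    unfolding expand by simp
  with quad[of u] have "f u + a + L / 2 * (norm (u - x))\<^sup>2 \<le> f x + b" by argo
  moreover have "(norm (G x))\<^sup>2 / (2 * L) = L / 2 * (norm (u - x))\<^sup>2"
    using L unfolding G by (simp add: norm_minus_commute power2_eq_square)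
  moreover have "x - (1 / L) *\<^sub>R G x = u" using L by (simp add: G)
  ultimately show ?thesis using a b by (simp add: composite_def)
qed

lemma ereal_sqrt_ge:
  assumes "0 \<le> a" "ereal (a\<^sup>2) \<le> c"
  shows "ereal a \<le> ereal_sqrt c"
  using assms by (cases c) (auto simp: ereal_sqrt_def intro: real_le_rsqrt)

theorem corollary7p3:
  fixes f :: "real ^ 'n \<Rightarrow> real"
    and \<Psi> :: "real ^ 'n \<Rightarrow> ereal"
    and L :: real
    and F :: "real ^ 'n \<Rightarrow> ereal"
    and Fmin :: ereal
    and xs :: "real ^ 'n"
    and x y z :: "nat \<Rightarrow> real ^ 'n"
    and M :: "nat \<Rightarrow> (real ^ 'n) set"
  defines "F \<equiv> composite f \<Psi>"
    and "Fmin \<equiv> (INF v. F v)"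
  assumes "L > 0"
    and "L_smooth L f"
    and "closed_proper_convex \<Psi>"
    and "is_arg_min F (\<lambda>_. True) xs"
    and "Fmin > -\<infinity>"
    and "idealized_run f \<Psi> L xs x y z M"
  shows "\<forall>k. ereal (Min ((\<lambda>j. norm (grad_map f \<Psi> (1 / L) (x j))) ` {0..k}))
            \<le> ereal_sqrt (ereal (2 * L) * (F (x 0) - Fmin) / ereal (real k + 1))"
proof
  fix k
  define G where "G = grad_map f \<Psi> (1 / L)"
  define \<mu> where "\<mu> = Min ((\<lambda>j. norm (G (x j))) ` {0..k})"
  have fin: "\<Psi> v \<noteq> -\<infinity>" for v
    using assms(5) by (simp add: closed_proper_convex_def)
  obtain p where "\<Psi> p \<noteq> \<infinity>"
    using assms(5) by (auto simp: closed_proper_convex_def)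
  have Fmin_le: "Fmin \<le> F v" for v
    unfolding Fmin_def by (simp add: INF_lower)
  \<comment> \<open>This makes \<open>Fmin\<close> a real number, whereas \<open>F (x 0)\<close> may
    still be infinite.\<close>
  have "F p \<noteq> \<infinity>" using \<open>\<Psi> p \<noteq> \<infinity>\<close> by (simp add: F_def composite_def)
  then obtain m where m: "Fmin = ereal m"
    using \<open>Fmin > -\<infinity>\<close> Fmin_le[of p] by (cases Fmin) auto
  have descent: "F (v - (1 / L) *\<^sub>R G v) + ereal ((norm (G v))\<^sup>2 / (2 * L)) \<le> F v" for v
    unfolding F_def G_def
    by (rule prox_gradient_descent[OF assms(3-5), of m]) (use Fmin_le m in \<open>simp add: F_def\<close>)
  have line: "v - (1 / L) *\<^sub>R G v \<in> line_along v (G v)" for v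
    unfolding line_along_def span_singleton
    by (auto intro!: image_eqI[of _ _ "(- (1 / L)) *\<^sub>R G v"])
  note run = assms(8)[unfolded idealized_run_def Let_def, folded G_def F_def]
  \<comment> \<open>For \<open>j = 0\<close> the line lies in \<open>M 1\<close> because
    \<open>z 0 = x 0\<close>; for later \<open>j\<close> the rule for \<open>M (j + 1)\<close>
    includes it.\<close>
  have mem: "x j - (1 / L) *\<^sub>R G (x j) \<in> M (Suc j)" for j
  proof (cases j)
    case 0
    then show ?thesis using run line[of "x 0"] by auto
  next
    case (Suc i)
    then have "line_along (x j) (G (x j)) \<subseteq> M (j + 1)" using run by simp
    then show ?thesis using line[of "x j"] by auto
  qed
  have step: "F (x (Suc j)) + ereal ((norm (G (x j)))\<^sup>2 / (2 * L)) \<le> F (x j)" for j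
  proof -
    have "is_arg_min F (\<lambda>v. v \<in> M (Suc j)) (x (Suc j))" using run by simp
    then have "F (x (Suc j)) \<le> F (x j - (1 / L) *\<^sub>R G (x j))"
      using mem by (simp add: is_arg_min_linorder)
    from add_right_mono[OF this] show ?thesis using descent by (rule order_trans)
  qed
  \<comment> \<open>The sum stays on the left, which avoids subtracting values of \<open>F\<close>
    that may be infinite.\<close>
  have tele: "F (x n) + ereal (\<Sum>j<n. (norm (G (x j)))\<^sup>2 / (2 * L)) \<le> F (x 0)" for n
  proof (induction n)
    case (Suc n)
    let ?S = "ereal (\<Sum>j<n. (norm (G (x j)))\<^sup>2 / (2 * L))"
    have "F (x (Suc n)) + ereal ((norm (G (x n)))\<^sup>2 / (2 * L)) + ?S \<le> F (x n) + ?S"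
      by (rule add_right_mono[OF step])
    also have "\<dots> \<le> F (x 0)" by (rule Suc)
    finally show ?case by (simp add: ac_simps flip: plus_ereal.simps)
  qed (simp add: zero_ereal_def[symmetric])
  have "0 \<le> \<mu>" by (simp add: \<mu>_def)
  \<comment> \<open>The minimum bounds each of the \<open>k + 1\<close> summands from below.\<close>
  have "\<mu>\<^sup>2 / (2 * L) \<le> (norm (G (x j)))\<^sup>2 / (2 * L)" if "j < Suc k" for j
    using that \<open>L > 0\<close> \<open>0 \<le> \<mu>\<close> by (intro divide_right_mono power_mono) (auto simp: \<mu>_def)
  then have "(\<Sum>j<Suc k. \<mu>\<^sup>2 / (2 * L)) \<le> (\<Sum>j<Suc k. (norm (G (x j)))\<^sup>2 / (2 * L))"
    by (intro sum_mono) auto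
  then have sum: "(real k + 1) * \<mu>\<^sup>2 / (2 * L) \<le> (\<Sum>j<Suc k. (norm (G (x j)))\<^sup>2 / (2 * L))"
    by (simp add: algebra_simps add_divide_distrib)
  have "ereal m + ereal (\<Sum>j<Suc k. (norm (G (x j)))\<^sup>2 / (2 * L)) \<le> F (x 0)"
    using add_right_mono[OF Fmin_le, unfolded m] tele by (rule order_trans)
  then have total: "ereal (m + (real k + 1) * \<mu>\<^sup>2 / (2 * L)) \<le> F (x 0)"
    using sum by (cases "F (x 0)") auto
  \<comment> \<open>If \<open>F (x 0)\<close> is infinite, so is the right-hand side, since
    \<open>Fmin\<close> is real.\<close>
  have "ereal (\<mu>\<^sup>2) \<le> ereal (2 * L) * (F (x 0) - Fmin) / ereal (real k + 1)"
  proof (cases "F (x 0)")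
    case (real c)
    then have "m + (real k + 1) * \<mu>\<^sup>2 / (2 * L) \<le> c" using total by simp
    then have "\<mu>\<^sup>2 \<le> 2 * L * (c - m) / (real k + 1)"
      using \<open>L > 0\<close> by (simp add: field_simps)
    then show ?thesis by (simp add: real m)
  next
    case PInf
    then show ?thesis using \<open>L > 0\<close> by (simp add: m)
  qed (use total in auto)
  with \<open>0 \<le> \<mu>\<close> show "ereal (Min ((\<lambda>j. norm (grad_map f \<Psi> (1 / L) (x j))) ` {0..k}))
      \<le> ereal_sqrt (ereal (2 * L) * (F (x 0) - Fmin) / ereal (real k + 1))"
    unfolding \<mu>_def G_def by (rule ereal_sqrt_ge)
qed

end
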